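(* Let $\Bbbk$ be a commutative, associative, unital ring, let $\mathcal{C}$ be a small EI category, and let $M$ be a $\Bbbk\mathcal{C}$-module. If $\operatorname{supp}(M)$ has a minimal element, then $\mathfrak{S}M\neq0$.
   Context: A category is EI if every endomorphism is an isomorphism. A $\Bbbk\mathcal{C}$-module is a functor $\mathcal{C}\to\Bbbk\text{-Mod}$. $\operatorname{cl}(\operatorname{obj}\mathcal{C})$ is the set of isomorphism classes of objects, partially ordered (for EI $\mathcal{C}$) by $\operatorname{cl}(c)\le\operatorname{cl}(d)$ iff there is a morphism $c\to d$. $\operatorname{supp}(M)=\{\operatorname{cl}(c):M(c)\ne0\}$, with the induced order. For each object $c$, $\mathfrak{S}M(c)$ is the quotient of $M(c)$ by the sum of the images of all $M(u)\colon M(b)\to M(c)$ with $u\colon b\to c$ a non-isomorphism of $\mathcal{C}$; this defines a functor $\mathfrak{S}M$ from $\mathrm{iso}\,\mathcal{C}$ (the subcategory of all isomorphisms of $\mathcal{C}$) to $\Bbbk$-modules, and $\mathfrak{S}M\ne0$ means $\mathfrak{S}M(c)\neq0$ for some $c$. *)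

theory Defs
  imports "HOL-Algebra.Order" "HOL-Algebra.AbelCoset" "HOL-Algebra.Module"
begin

section \<open>Small categories\<close>

text \<open>Objects and arrows form sets; composition is written in function order,
  i.e. \<open>Comp C v u\<close> is \<open>v\<close> after \<open>u\<close>. All operations are only meaningful on the carriers
  \<open>Obj C\<close> and \<open>Arr C\<close>.\<close>

record ('o, 'a) category =
  Obj :: "'o set"
  Arr :: "'a set"
  Src :: "'a \<Rightarrow> 'o"
  Tgt :: "'a \<Rightarrow> 'o"
  Ident :: "'o \<Rightarrow> 'a"
  Comp :: "'a \<Rightarrow> 'a \<Rightarrow> 'a"

definition Hom :: "('o, 'a) category \<Rightarrow> 'o \<Rightarrow> 'o \<Rightarrow> 'a set" where
  "Hom C a b = {f \<in> Arr C. Src C f = a \<and> Tgt C f = b}"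

locale small_category =
  fixes C :: "('o, 'a) category"
  assumes src_obj: "f \<in> Arr C \<Longrightarrow> Src C f \<in> Obj C"
    and tgt_obj: "f \<in> Arr C \<Longrightarrow> Tgt C f \<in> Obj C"
    and ident_hom: "a \<in> Obj C \<Longrightarrow> Ident C a \<in> Hom C a a"
    and comp_hom: "\<lbrakk>u \<in> Hom C a b; v \<in> Hom C b c\<rbrakk> \<Longrightarrow> Comp C v u \<in> Hom C a c"
    and comp_ident_right: "u \<in> Hom C a b \<Longrightarrow> Comp C u (Ident C a) = u"
    and comp_ident_left: "u \<in> Hom C a b \<Longrightarrow> Comp C (Ident C b) u = u"
    and comp_assoc: "\<lbrakk>u \<in> Hom C a b; v \<in> Hom C b c; w \<in> Hom C c d\<rbrakk>
          \<Longrightarrow> Comp C w (Comp C v u) = Comp C (Comp C w v) u"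

definition is_iso :: "('o, 'a) category \<Rightarrow> 'a \<Rightarrow> bool" where
  "is_iso C f \<longleftrightarrow> f \<in> Arr C \<and>
     (\<exists>g \<in> Hom C (Tgt C f) (Src C f).
        Comp C g f = Ident C (Src C f) \<and> Comp C f g = Ident C (Tgt C f))"

locale EI_category = small_category +
  assumes endo_iso: "\<lbrakk>f \<in> Arr C; Src C f = Tgt C f\<rbrakk> \<Longrightarrow> is_iso C f"

definition iso_category :: "('o, 'a) category \<Rightarrow> ('o, 'a) category" where
  "iso_category C = C\<lparr>Arr := {f \<in> Arr C. is_iso C f}\<rparr>"

definition iso_class :: "('o, 'a) category \<Rightarrow> 'o \<Rightarrow> 'o set" where
  "iso_class C c = {d \<in> Obj C. \<exists>f \<in> Hom C c d. is_iso C f}"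

definition cl_order :: "('o, 'a) category \<Rightarrow> 'o set gorder" where
  "cl_order C =
    \<lparr>carrier = iso_class C ` Obj C,
     eq = (=),
     le = (\<lambda>X Y. \<exists>c \<in> Obj C. \<exists>d \<in> Obj C.
             X = iso_class C c \<and> Y = iso_class C d \<and> Hom C c d \<noteq> {})\<rparr>"

definition minimal_element :: "('p, 'z) gorder_scheme \<Rightarrow> 'p \<Rightarrow> bool" where
  "minimal_element L x \<longleftrightarrow>
     x \<in> carrier L \<and> (\<forall>y \<in> carrier L. y \<sqsubseteq>\<^bsub>L\<^esub> x \<longrightarrow> y .=\<^bsub>L\<^esub> x)"


section \<open>Modules over a commutative ring\<close>

definition mod_hom ::
    "('k, 'z) ring_scheme \<Rightarrow> ('k, 'm) module \<Rightarrow> ('k, 'n) module \<Rightarrow> ('m \<Rightarrow> 'n) set" where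
  "mod_hom K M N = {f \<in> hom (add_monoid M) (add_monoid N).
     \<forall>a \<in> carrier K. \<forall>x \<in> carrier M. f (a \<odot>\<^bsub>M\<^esub> x) = a \<odot>\<^bsub>N\<^esub> f x}"

definition nonzero_module :: "('k, 'm) module \<Rightarrow> bool" where
  "nonzero_module N \<longleftrightarrow> carrier N \<noteq> {\<zero>\<^bsub>N\<^esub>}"

definition sum_submodules :: "('k, 'm, 'y) module_scheme \<Rightarrow> 'i set \<Rightarrow> ('i \<Rightarrow> 'm set) \<Rightarrow> 'm set" where
  "sum_submodules N I S = {finsum N f F | f F. finite F \<and> F \<subseteq> I \<and> (\<forall>i \<in> F. f i \<in> S i)}"

text \<open>The record type \<open>module\<close> extends \<open>ring\<close>; the fields \<open>mult\<close> and \<open>one\<close> play no role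
  for modules.\<close>

definition quotient_module :: "('k, 'm) module \<Rightarrow> 'm set \<Rightarrow> ('k, 'm set) module" where
  "quotient_module N H =
    \<lparr>carrier = a_rcosets\<^bsub>N\<^esub> H, mult = undefined, one = undefined,
     zero = H, add = set_add N,
     smult = (\<lambda>a X. \<Union>x \<in> X. H +>\<^bsub>N\<^esub> (a \<odot>\<^bsub>N\<^esub> x))\<rparr>"


section \<open>Modules over a category\<close>

record ('o, 'a, 'k, 'm) functor_data =
  MObj :: "'o \<Rightarrow> ('k, 'm) module"
  MMap :: "'a \<Rightarrow> 'm \<Rightarrow> 'm"

locale category_module = cring K + small_category C
  for K :: "('k, 'z) ring_scheme" (structure)
    and C :: "('o, 'a) category"
    and M :: "('o, 'a, 'k, 'm) functor_data" +
  assumes MObj_module: "c \<in> Obj C \<Longrightarrow> module K (MObj M c)"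
    and MMap_hom: "u \<in> Hom C b c \<Longrightarrow> MMap M u \<in> mod_hom K (MObj M b) (MObj M c)"
    and MMap_ident: "\<lbrakk>c \<in> Obj C; x \<in> carrier (MObj M c)\<rbrakk> \<Longrightarrow> MMap M (Ident C c) x = x"
    and MMap_comp: "\<lbrakk>u \<in> Hom C a b; v \<in> Hom C b c; x \<in> carrier (MObj M a)\<rbrakk>
          \<Longrightarrow> MMap M (Comp C v u) x = MMap M v (MMap M u x)"

definition nonzero_functor ::
    "('o, 'a) category \<Rightarrow> ('o, 'a, 'k, 'm) functor_data \<Rightarrow> bool" where
  "nonzero_functor C M \<longleftrightarrow> (\<exists>c \<in> Obj C. nonzero_module (MObj M c))"

definition supp :: "('o, 'a) category \<Rightarrow> ('o, 'a, 'k, 'm) functor_data \<Rightarrow> 'o set set" where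
  "supp C M = {iso_class C c | c. c \<in> Obj C \<and> nonzero_module (MObj M c)}"

definition supp_order ::
    "('o, 'a) category \<Rightarrow> ('o, 'a, 'k, 'm) functor_data \<Rightarrow> 'o set gorder" where
  "supp_order C M = (cl_order C)\<lparr>carrier := supp C M\<rparr>"

definition non_iso_image ::
    "('o, 'a) category \<Rightarrow> ('o, 'a, 'k, 'm) functor_data \<Rightarrow> 'o \<Rightarrow> 'm set" where
  "non_iso_image C M c =
     sum_submodules (MObj M c) {u \<in> Arr C. Tgt C u = c \<and> \<not> is_iso C u}
       (\<lambda>u. MMap M u ` carrier (MObj M (Src C u)))"

text \<open>On an isomorphism \<open>f\<close>, the map induced between the quotients sends the coset of \<open>x\<close>
  to the coset of \<open>M(f) x\<close>.\<close>

definition splitting_functor ::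
    "('o, 'a) category \<Rightarrow> ('o, 'a, 'k, 'm) functor_data \<Rightarrow> ('o, 'a, 'k, 'm set) functor_data"
    (\<open>\<SS>\<close>) where
  "\<SS> C M =
    \<lparr>MObj = (\<lambda>c. quotient_module (MObj M c) (non_iso_image C M c)),
     MMap = (\<lambda>f X. \<Union>x \<in> X. non_iso_image C M (Tgt C f) +>\<^bsub>MObj M (Tgt C f)\<^esub> MMap M f x)\<rparr>"


section \<open>Well-definedness\<close>

context small_category
begin

lemma hom_obj: "u \<in> Hom C a b \<Longrightarrow> a \<in> Obj C \<and> b \<in> Obj C"
  using src_obj tgt_obj by (auto simp: Hom_def)

lemma is_iso_hom_iff:
  assumes "f \<in> Hom C a b"
  shows "is_iso C f \<longleftrightarrow> (\<exists>g \<in> Hom C b a. Comp C g f = Ident C a \<and> Comp C f g = Ident C b)"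
  using assms by (auto simp: is_iso_def Hom_def)

lemma is_iso_ident: "a \<in> Obj C \<Longrightarrow> is_iso C (Ident C a)"
  using ident_hom[of a] comp_ident_left[of "Ident C a" a a] is_iso_hom_iff[of "Ident C a" a a]
  by auto

lemma is_iso_inverse:
  assumes "f \<in> Hom C a b" "is_iso C f"
  obtains g where "g \<in> Hom C b a" "is_iso C g" "Comp C g f = Ident C a" "Comp C f g = Ident C b"
proof -
  obtain g where g: "g \<in> Hom C b a" "Comp C g f = Ident C a" "Comp C f g = Ident C b"
    using assms is_iso_hom_iff by blast
  then have "is_iso C g" using is_iso_hom_iff[OF g(1)] assms(1) by auto
  with g that show thesis by blast
qed

lemma comp_cancel:
  assumes "u \<in> Hom C a b" "v \<in> Hom C b c" "w \<in> Hom C c b" "Comp C w v = Ident C b"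
  shows "Comp C w (Comp C v u) = u"
  using comp_assoc[OF assms(1,2,3)] comp_ident_left[OF assms(1)] assms(4) by simp

lemma is_iso_comp:
  assumes f: "f \<in> Hom C a b" "is_iso C f" and g: "g \<in> Hom C b c" "is_iso C g"
  shows "is_iso C (Comp C g f)"
proof -
  obtain f' where f': "f' \<in> Hom C b a" "Comp C f' f = Ident C a" "Comp C f f' = Ident C b"
    using is_iso_inverse[OF f] by metis
  obtain g' where g': "g' \<in> Hom C c b" "Comp C g' g = Ident C b" "Comp C g g' = Ident C c"
    using is_iso_inverse[OF g] by metis
  have gf: "Comp C g f \<in> Hom C a c" and fg: "Comp C f' g' \<in> Hom C c a"
    using comp_hom f(1) g(1) f'(1) g'(1) by blast+
  have 1: "Comp C (Comp C f' g') (Comp C g f) = Ident C a"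
    using comp_assoc[OF gf g'(1) f'(1)] comp_cancel[OF f(1) g(1) g'(1,2)] f'(2) by simp
  have 2: "Comp C (Comp C g f) (Comp C f' g') = Ident C c"
    using comp_assoc[OF fg f(1) g(1)] comp_cancel[OF g'(1) f'(1) f(1) f'(3)] g'(3) by simp
  show ?thesis using is_iso_hom_iff[OF gf] fg 1 2 by blast
qed

lemma non_iso_comp_iso:
  assumes u: "u \<in> Hom C a b" "\<not> is_iso C u" and f: "f \<in> Hom C b c" "is_iso C f"
  shows "\<not> is_iso C (Comp C f u)"
proof
  assume iso: "is_iso C (Comp C f u)"
  obtain g where g: "g \<in> Hom C c b" "is_iso C g" "Comp C g f = Ident C b"
    using is_iso_inverse[OF f] by metis
  have "is_iso C (Comp C g (Comp C f u))"
    using is_iso_comp[OF comp_hom[OF u(1) f(1)] iso g(1,2)] .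
  with comp_cancel[OF u(1) f(1) g(1,3)] u(2) show False by simp
qed

lemma iso_class_eq_iff:
  assumes "c \<in> Obj C" "d \<in> Obj C"
  shows "iso_class C c = iso_class C d \<longleftrightarrow> (\<exists>f \<in> Hom C c d. is_iso C f)"
proof
  assume "iso_class C c = iso_class C d"
  moreover have "d \<in> iso_class C d"
    using assms ident_hom is_iso_ident by (auto simp: iso_class_def)
  ultimately show "\<exists>f \<in> Hom C c d. is_iso C f" by (auto simp: iso_class_def)
next
  assume "\<exists>f \<in> Hom C c d. is_iso C f"
  then obtain f where f: "f \<in> Hom C c d" "is_iso C f" by blast
  obtain g where g: "g \<in> Hom C d c" "is_iso C g"
    using is_iso_inverse[OF f] by metis
  show "iso_class C c = iso_class C d"
    unfolding iso_class_def using f g comp_hom is_iso_comp by blast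
qed

lemma cl_le_iff:
  assumes "c \<in> Obj C" "d \<in> Obj C"
  shows "iso_class C c \<sqsubseteq>\<^bsub>cl_order C\<^esub> iso_class C d \<longleftrightarrow> Hom C c d \<noteq> {}"
proof
  assume "iso_class C c \<sqsubseteq>\<^bsub>cl_order C\<^esub> iso_class C d"
  then obtain c' d' h where h: "c' \<in> Obj C" "d' \<in> Obj C" "iso_class C c = iso_class C c'"
      "iso_class C d' = iso_class C d" "h \<in> Hom C c' d'"
    by (fastforce simp: cl_order_def)
  then obtain f g where "f \<in> Hom C c c'" "g \<in> Hom C d' d"
    using iso_class_eq_iff assms by meson
  with h(5) comp_hom show "Hom C c d \<noteq> {}" by blast
qed (use assms in \<open>auto simp: cl_order_def\<close>)

lemma iso_category_hom: "f \<in> Hom (iso_category C) a b \<longleftrightarrow> f \<in> Hom C a b \<and> is_iso C f"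
  by (auto simp: Hom_def iso_category_def)

lemma iso_category_simps [simp]:
  "Obj (iso_category C) = Obj C" "Src (iso_category C) = Src C" "Tgt (iso_category C) = Tgt C"
  "Ident (iso_category C) = Ident C" "Comp (iso_category C) = Comp C"
  by (auto simp: iso_category_def)

lemma iso_category_small: "small_category (iso_category C)"
proof
  fix f assume "f \<in> Arr (iso_category C)"
  then have "f \<in> Arr C" by (simp add: iso_category_def)
  then show "Src (iso_category C) f \<in> Obj (iso_category C)"
    "Tgt (iso_category C) f \<in> Obj (iso_category C)"
    using src_obj tgt_obj by auto
qed (auto simp: iso_category_hom ident_hom is_iso_ident comp_ident_left comp_ident_right
       intro: comp_hom is_iso_comp comp_assoc)

end

lemma (in EI_category) cl_order_partial_order: "partial_order (cl_order C)"
proof -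
  have antisym: "X = Y" if XY: "X \<in> carrier (cl_order C)" "Y \<in> carrier (cl_order C)"
    "X \<sqsubseteq>\<^bsub>cl_order C\<^esub> Y" "Y \<sqsubseteq>\<^bsub>cl_order C\<^esub> X" for X Y
  proof -
    obtain c d where cd: "c \<in> Obj C" "d \<in> Obj C" "X = iso_class C c" "Y = iso_class C d"
      using XY(1,2) by (auto simp: cl_order_def)
    then obtain f g where fg: "f \<in> Hom C c d" "g \<in> Hom C d c"
      using XY(3,4) cl_le_iff by blast
    let ?e = "Comp C g f" and ?e' = "Comp C f g"
    have e: "?e \<in> Hom C c c" "?e' \<in> Hom C d d" using fg comp_hom by blast+
    then have "is_iso C ?e" "is_iso C ?e'" using endo_iso by (auto simp: Hom_def)
    then obtain p q where p: "p \<in> Hom C c c" "Comp C p ?e = Ident C c"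
      and q: "q \<in> Hom C d d" "Comp C ?e' q = Ident C d"
      using e is_iso_hom_iff by meson
    let ?l = "Comp C p g" and ?r = "Comp C g q"
    have l: "?l \<in> Hom C d c" "Comp C ?l f = Ident C c"
      using p fg comp_hom comp_assoc[OF fg p(1)] by auto
    have r: "?r \<in> Hom C d c" "Comp C f ?r = Ident C d"
      using q fg comp_hom comp_assoc[OF q(1) fg(2,1)] by auto
    have "?l = Comp C ?l (Comp C f ?r)" using l r comp_ident_right by simp
    also have "\<dots> = ?r" using comp_cancel[OF r(1) fg(1) l] .
    finally have "is_iso C f" using is_iso_hom_iff[OF fg(1)] l r by auto
    with fg cd iso_class_eq_iff show ?thesis by blast
  qed
  have trans: "X \<sqsubseteq>\<^bsub>cl_order C\<^esub> Z" if
    "X \<in> carrier (cl_order C)" "Y \<in> carrier (cl_order C)" "Z \<in> carrier (cl_order C)"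
    "X \<sqsubseteq>\<^bsub>cl_order C\<^esub> Y" "Y \<sqsubseteq>\<^bsub>cl_order C\<^esub> Z" for X Y Z
  proof -
    obtain a b c where abc: "a \<in> Obj C" "b \<in> Obj C" "c \<in> Obj C"
      "X = iso_class C a" "Y = iso_class C b" "Z = iso_class C c"
      using \<open>X \<in> _\<close> \<open>Y \<in> _\<close> \<open>Z \<in> _\<close> by (auto simp: cl_order_def)
    with that cl_le_iff have "Hom C a b \<noteq> {}" "Hom C b c \<noteq> {}" by auto
    with comp_hom have "Hom C a c \<noteq> {}" by blast
    with abc cl_le_iff show ?thesis by blast
  qed
  have refl: "X \<sqsubseteq>\<^bsub>cl_order C\<^esub> X" if X: "X \<in> carrier (cl_order C)" for X
  proof -
    obtain c where c: "c \<in> Obj C" "X = iso_class C c" using X by (auto simp: cl_order_def)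
    with ident_hom cl_le_iff show ?thesis by blast
  qed
  have eq: "(.=\<^bsub>cl_order C\<^esub>) = (=)" by (simp add: cl_order_def)
  show ?thesis
    by unfold_locales (simp_all only: eq refl, (metis antisym), (metis trans))
qed

lemma sum_submodulesI:
  "\<lbrakk>x = finsum N f F; finite F; F \<subseteq> I; \<And>i. i \<in> F \<Longrightarrow> f i \<in> S i\<rbrakk> \<Longrightarrow> x \<in> sum_submodules N I S"
  unfolding sum_submodules_def by blast

context module
begin

lemma sum_submodules_submodule:
  assumes S: "\<And>i. i \<in> I \<Longrightarrow> submodule (S i) R M"
  shows "submodule (sum_submodules M I S) R M"
proof (rule submoduleI)
  note sub = submoduleE[OF S]
  have car: "f \<in> F \<rightarrow> carrier M" if "F \<subseteq> I" "\<forall>i\<in>F. f i \<in> S i" for f F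
    using that sub(1) by blast
  have zero: "\<zero>\<^bsub>M\<^esub> \<in> S i" if "i \<in> I" for i
    using subgroup.one_closed[OF submodule.axioms(1)[OF S[OF that]]] by simp
  have smult: "a \<odot>\<^bsub>M\<^esub> x \<in> sum_submodules M I S"
    if "a \<in> carrier R" "x \<in> sum_submodules M I S" for a x
  proof -
    obtain f F where f: "x = finsum M f F" "finite F" "F \<subseteq> I" "\<forall>i\<in>F. f i \<in> S i"
      using \<open>x \<in> _\<close> by (auto simp: sum_submodules_def)
    then have "a \<odot>\<^bsub>M\<^esub> x = finsum M (\<lambda>i. a \<odot>\<^bsub>M\<^esub> f i) F"
      using finsum_smult_ldistr that car by blast
    moreover have "\<forall>i\<in>F. a \<odot>\<^bsub>M\<^esub> f i \<in> S i" using f sub(4) that by blast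
    ultimately show ?thesis using f by (intro sum_submodulesI[of _ M _ F]) auto
  qed
  show sc: "sum_submodules M I S \<subseteq> carrier M"
    using car by (auto simp: sum_submodules_def)
  show "\<zero>\<^bsub>M\<^esub> \<in> sum_submodules M I S"
    by (rule sum_submodulesI[of _ M "\<lambda>_. \<zero>\<^bsub>M\<^esub>" "{}"]) auto
  show "\<ominus>\<^bsub>M\<^esub> x \<in> sum_submodules M I S" if "x \<in> sum_submodules M I S" for x
    using smult[of "\<ominus> \<one>" x] smult_l_minus[of \<one> x] that sc by auto
  show "a \<odot>\<^bsub>M\<^esub> x \<in> sum_submodules M I S"
    if "a \<in> carrier R" "x \<in> sum_submodules M I S" for a x
    using smult that .
  show "x \<oplus>\<^bsub>M\<^esub> y \<in> sum_submodules M I S"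
    if xy: "x \<in> sum_submodules M I S" "y \<in> sum_submodules M I S" for x y
  proof -
    obtain f F g G where f: "x = finsum M f F" "finite F" "F \<subseteq> I" "\<forall>i\<in>F. f i \<in> S i"
      and g: "y = finsum M g G" "finite G" "G \<subseteq> I" "\<forall>i\<in>G. g i \<in> S i"
      using xy by (auto simp: sum_submodules_def)
    define f' where "f' i = (if i \<in> F then f i else \<zero>\<^bsub>M\<^esub>)" for i
    define g' where "g' i = (if i \<in> G then g i else \<zero>\<^bsub>M\<^esub>)" for i
    have f': "f' i \<in> S i" if "i \<in> F \<union> G" for i using that f g zero by (auto simp: f'_def)
    have g': "g' i \<in> S i" if "i \<in> F \<union> G" for i using that f g zero by (auto simp: g'_def)
    have FG: "F \<union> G \<subseteq> I" using f g by blast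
    have "x = finsum M f' (F \<union> G)" unfolding f(1)
      by (rule M.add.finprod_mono_neutral_cong_left)
        (use f g f' car[of F f] car[OF FG, of f'] in \<open>auto simp: f'_def\<close>)
    moreover have "y = finsum M g' (F \<union> G)" unfolding g(1)
      by (rule M.add.finprod_mono_neutral_cong_left)
        (use f g g' car[of G g] car[OF FG, of g'] in \<open>auto simp: g'_def\<close>)
    ultimately have "x \<oplus>\<^bsub>M\<^esub> y = finsum M (\<lambda>i. f' i \<oplus>\<^bsub>M\<^esub> g' i) (F \<union> G)"
      using M.finsum_addf[of f' "F \<union> G" g'] car[OF FG, of f'] car[OF FG, of g'] f' g' by auto
    moreover have "\<forall>i\<in>F \<union> G. f' i \<oplus>\<^bsub>M\<^esub> g' i \<in> S i" using f' g' FG sub(5) by blast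
    ultimately show ?thesis
      using FG f(2) g(2) by (intro sum_submodulesI[of _ M _ "F \<union> G"]) auto
  qed
qed

end

lemma a_r_coset_iff:
  "y \<in> H +>\<^bsub>N\<^esub> x \<longleftrightarrow> (\<exists>h \<in> H. y = h \<oplus>\<^bsub>N\<^esub> x)"
  by (auto simp: a_r_coset_def r_coset_def)

context
  fixes K :: "('k, 'z) ring_scheme" and N :: "('k, 'm) module" and H :: "'m set"
  assumes N: "module K N" and H: "submodule H K N"
begin

interpretation module K N by (rule N)

lemma quotient_abelian_subgroup: "abelian_subgroup H N"
  by (intro abelian_subgroupI3 additive_subgroupI submodule.axioms(1)[OF H]
        M.abelian_group_axioms)

interpretation abelian_subgroup H N by (rule quotient_abelian_subgroup)

lemma coset_eqI: "\<lbrakk>y \<in> H +>\<^bsub>N\<^esub> x; x \<in> carrier N\<rbrakk> \<Longrightarrow> H +>\<^bsub>N\<^esub> y = H +>\<^bsub>N\<^esub> x"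
  by (rule a_repr_independence[OF _ _ a_subgroup, symmetric])

text \<open>A map compatible with cosets induces a map on cosets.\<close>

lemma coset_UN:
  assumes x: "x \<in> carrier N"
    and \<phi>: "\<And>y. y \<in> H +>\<^bsub>N\<^esub> x \<Longrightarrow> \<phi> y = \<phi> x"
  shows "(\<Union>y \<in> H +>\<^bsub>N\<^esub> x. \<phi> y) = \<phi> x"
  by (rule SUP_eq_const, use a_rcos_self[OF x] in blast, rule \<phi>)

lemma quotient_smult:
  assumes a: "a \<in> carrier K" and x: "x \<in> carrier N"
  shows "a \<odot>\<^bsub>quotient_module N H\<^esub> (H +>\<^bsub>N\<^esub> x) = H +>\<^bsub>N\<^esub> (a \<odot>\<^bsub>N\<^esub> x)"
proof -
  have "H +>\<^bsub>N\<^esub> (a \<odot>\<^bsub>N\<^esub> y) = H +>\<^bsub>N\<^esub> (a \<odot>\<^bsub>N\<^esub> x)" if y: "y \<in> H +>\<^bsub>N\<^esub> x" for y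
  proof (rule coset_eqI)
    obtain h where h: "h \<in> H" "y = h \<oplus>\<^bsub>N\<^esub> x"
      by (rule bexE[OF iffD1[OF a_r_coset_iff y]]) (rule that)
    have "a \<odot>\<^bsub>N\<^esub> y = a \<odot>\<^bsub>N\<^esub> h \<oplus>\<^bsub>N\<^esub> a \<odot>\<^bsub>N\<^esub> x"
      unfolding h(2) by (rule smult_r_distr[OF a subsetD[OF a_subset h(1)] x])
    then show "a \<odot>\<^bsub>N\<^esub> y \<in> H +>\<^bsub>N\<^esub> (a \<odot>\<^bsub>N\<^esub> x)"
      by (rule iffD2[OF a_r_coset_iff bexI[OF _ submodule.smult_closed[OF H a h(1)]]])
    show "a \<odot>\<^bsub>N\<^esub> x \<in> carrier N" using a x by (rule smult_closed)
  qed
  then show ?thesis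
    unfolding quotient_module_def by (simp only: module.simps) (rule coset_UN[OF x])
qed

lemma quotient_carrier:
  "X \<in> carrier (quotient_module N H) \<longleftrightarrow> (\<exists>x \<in> carrier N. X = H +>\<^bsub>N\<^esub> x)"
  by (auto simp: quotient_module_def A_RCOSETS_def')

lemma quotient_carrierI: "x \<in> carrier N \<Longrightarrow> H +>\<^bsub>N\<^esub> x \<in> carrier (quotient_module N H)"
  using quotient_carrier by blast

lemma quotient_carrierE:
  assumes "X \<in> carrier (quotient_module N H)"
  obtains x where "x \<in> carrier N" "X = H +>\<^bsub>N\<^esub> x"
  using assms quotient_carrier by blast

lemma quotient_add:
  "\<lbrakk>x \<in> carrier N; y \<in> carrier N\<rbrakk> \<Longrightarrow>
    (H +>\<^bsub>N\<^esub> x) \<oplus>\<^bsub>quotient_module N H\<^esub> (H +>\<^bsub>N\<^esub> y) = H +>\<^bsub>N\<^esub> (x \<oplus>\<^bsub>N\<^esub> y)"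
  by (simp add: quotient_module_def a_rcos_sum)

lemma quotient_zero: "\<zero>\<^bsub>quotient_module N H\<^esub> = H +>\<^bsub>N\<^esub> \<zero>\<^bsub>N\<^esub>"
  using a_subset by (simp add: quotient_module_def)

lemma quotient_module_module: "module K (quotient_module N H)"
proof (rule moduleI)
  let ?Q = "quotient_module N H"
  note [simp] = quotient_add quotient_smult quotient_carrierI quotient_zero
    and [simp del] = a_coset_add_zero
  show "cring K" using N by (simp add: module_def)
  show "abelian_group ?Q"
  proof (rule abelian_groupI)
    show "X \<oplus>\<^bsub>?Q\<^esub> Y \<in> carrier ?Q" if "X \<in> carrier ?Q" "Y \<in> carrier ?Q" for X Y
      by (rule that(1)[THEN quotient_carrierE], rule that(2)[THEN quotient_carrierE]) simp
    show "\<zero>\<^bsub>?Q\<^esub> \<in> carrier ?Q" by simp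
    show "(X \<oplus>\<^bsub>?Q\<^esub> Y) \<oplus>\<^bsub>?Q\<^esub> Z = X \<oplus>\<^bsub>?Q\<^esub> (Y \<oplus>\<^bsub>?Q\<^esub> Z)"
      if "X \<in> carrier ?Q" "Y \<in> carrier ?Q" "Z \<in> carrier ?Q" for X Y Z
      by (rule that(1)[THEN quotient_carrierE], rule that(2)[THEN quotient_carrierE],
          rule that(3)[THEN quotient_carrierE]) (simp add: M.a_assoc)
    show "X \<oplus>\<^bsub>?Q\<^esub> Y = Y \<oplus>\<^bsub>?Q\<^esub> X" if "X \<in> carrier ?Q" "Y \<in> carrier ?Q" for X Y
      by (rule that(1)[THEN quotient_carrierE], rule that(2)[THEN quotient_carrierE])
        (simp add: M.a_comm)
    show "\<zero>\<^bsub>?Q\<^esub> \<oplus>\<^bsub>?Q\<^esub> X = X" if "X \<in> carrier ?Q" for X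
      by (rule that[THEN quotient_carrierE]) simp
    show "\<exists>Y \<in> carrier ?Q. Y \<oplus>\<^bsub>?Q\<^esub> X = \<zero>\<^bsub>?Q\<^esub>" if "X \<in> carrier ?Q" for X
    proof (rule that[THEN quotient_carrierE])
      fix x assume x: "x \<in> carrier N" "X = H +>\<^bsub>N\<^esub> x"
      show ?thesis
        by (rule bexI[of _ "H +>\<^bsub>N\<^esub> (\<ominus>\<^bsub>N\<^esub> x)"]) (simp_all add: x M.l_neg)
    qed
  qed
  show "a \<odot>\<^bsub>?Q\<^esub> X \<in> carrier ?Q" if "a \<in> carrier K" "X \<in> carrier ?Q" for a X
    by (rule that(2)[THEN quotient_carrierE]) (simp add: that(1))
  show "\<one>\<^bsub>K\<^esub> \<odot>\<^bsub>?Q\<^esub> X = X" if "X \<in> carrier ?Q" for X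
    by (rule that[THEN quotient_carrierE]) simp
  show "(a \<oplus>\<^bsub>K\<^esub> b) \<odot>\<^bsub>?Q\<^esub> X = a \<odot>\<^bsub>?Q\<^esub> X \<oplus>\<^bsub>?Q\<^esub> b \<odot>\<^bsub>?Q\<^esub> X"
    if "a \<in> carrier K" "b \<in> carrier K" "X \<in> carrier ?Q" for a b X
    by (rule that(3)[THEN quotient_carrierE]) (simp add: that(1,2) smult_l_distr)
  show "a \<odot>\<^bsub>?Q\<^esub> (X \<oplus>\<^bsub>?Q\<^esub> Y) = a \<odot>\<^bsub>?Q\<^esub> X \<oplus>\<^bsub>?Q\<^esub> a \<odot>\<^bsub>?Q\<^esub> Y"
    if "a \<in> carrier K" "X \<in> carrier ?Q" "Y \<in> carrier ?Q" for a X Y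
    by (rule that(2)[THEN quotient_carrierE], rule that(3)[THEN quotient_carrierE])
      (simp add: that(1) smult_r_distr)
  show "(a \<otimes>\<^bsub>K\<^esub> b) \<odot>\<^bsub>?Q\<^esub> X = a \<odot>\<^bsub>?Q\<^esub> (b \<odot>\<^bsub>?Q\<^esub> X)"
    if "a \<in> carrier K" "b \<in> carrier K" "X \<in> carrier ?Q" for a b X
    by (rule that(3)[THEN quotient_carrierE]) (simp add: that(1,2) smult_assoc1)
qed

end

lemma mod_homI:
  assumes "\<And>x. x \<in> carrier M \<Longrightarrow> f x \<in> carrier N"
    and "\<And>x y. \<lbrakk>x \<in> carrier M; y \<in> carrier M\<rbrakk> \<Longrightarrow> f (x \<oplus>\<^bsub>M\<^esub> y) = f x \<oplus>\<^bsub>N\<^esub> f y"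
    and "\<And>a x. \<lbrakk>a \<in> carrier K; x \<in> carrier M\<rbrakk> \<Longrightarrow> f (a \<odot>\<^bsub>M\<^esub> x) = a \<odot>\<^bsub>N\<^esub> f x"
  shows "f \<in> mod_hom K M N"
  using assms by (auto simp: mod_hom_def hom_def)

lemma mod_hom_module_sum:
  assumes M: "module K M" and N: "module K N" and f: "f \<in> mod_hom K M N"
    and F: "finite F" "g \<in> F \<rightarrow> carrier M"
  shows "f (finsum M g F) = finsum N (\<lambda>i. f (g i)) F"
proof -
  interpret M: module K M by (rule M)
  interpret N: module K N by (rule N)
  have add: "f (x \<oplus>\<^bsub>M\<^esub> y) = f x \<oplus>\<^bsub>N\<^esub> f y" "f x \<in> carrier N"
    if "x \<in> carrier M" "y \<in> carrier M" for x y
    using f that by (auto simp: mod_hom_def hom_def)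
  have "f \<zero>\<^bsub>M\<^esub> \<oplus>\<^bsub>N\<^esub> f \<zero>\<^bsub>M\<^esub> = f \<zero>\<^bsub>M\<^esub>" using add(1)[of "\<zero>\<^bsub>M\<^esub>" "\<zero>\<^bsub>M\<^esub>"] by simp
  then have "f \<zero>\<^bsub>M\<^esub> = \<zero>\<^bsub>N\<^esub>" using add(2)[of "\<zero>\<^bsub>M\<^esub>" "\<zero>\<^bsub>M\<^esub>"] N.M.add.l_cancel_one by auto
  with F show ?thesis
  proof (induction F rule: finite_induct)
    case (insert i F)
    then have "finsum M g F \<in> carrier M" "g i \<in> carrier M"
      "(\<lambda>i. f (g i)) \<in> F \<rightarrow> carrier N" "f (g i) \<in> carrier N"
      using add(2) by (auto intro!: M.M.finsum_closed)
    with insert add show ?case by simp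
  qed simp
qed

lemma mod_hom_image_submodule:
  assumes M: "module K M" and N: "module K N" and f: "f \<in> mod_hom K M N"
  shows "submodule (f ` carrier M) K N"
proof -
  interpret M: module K M by (rule M)
  interpret N: module K N by (rule N)
  have add: "f (x \<oplus>\<^bsub>M\<^esub> y) = f x \<oplus>\<^bsub>N\<^esub> f y" "f x \<in> carrier N"
    if "x \<in> carrier M" "y \<in> carrier M" for x y
    using f that by (auto simp: mod_hom_def hom_def)
  have smult: "f (a \<odot>\<^bsub>M\<^esub> x) = a \<odot>\<^bsub>N\<^esub> f x" if "a \<in> carrier K" "x \<in> carrier M" for a x
    using f that by (auto simp: mod_hom_def)
  have zero: "f \<zero>\<^bsub>M\<^esub> = \<zero>\<^bsub>N\<^esub>"
    using mod_hom_module_sum[OF M N f, of "{}" "\<lambda>_. \<zero>\<^bsub>M\<^esub>"] by simp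
  have minus: "\<ominus>\<^bsub>N\<^esub> f x = f (\<ominus>\<^bsub>M\<^esub> x)" if "x \<in> carrier M" for x
    using smult[of "\<ominus>\<^bsub>K\<^esub> \<one>\<^bsub>K\<^esub>" x] that M.smult_l_minus[of "\<one>\<^bsub>K\<^esub>" x]
      N.smult_l_minus[of "\<one>\<^bsub>K\<^esub>" "f x"] add(2)[OF that that] by simp
  show ?thesis
  proof (rule N.submoduleI)
    show "f ` carrier M \<subseteq> carrier N" using add(2) by blast
    show "\<zero>\<^bsub>N\<^esub> \<in> f ` carrier M" using zero by (metis M.M.zero_closed imageI)
    show "\<ominus>\<^bsub>N\<^esub> y \<in> f ` carrier M" if "y \<in> f ` carrier M" for y
      using that minus by auto
    show "y \<oplus>\<^bsub>N\<^esub> z \<in> f ` carrier M" if "y \<in> f ` carrier M" "z \<in> f ` carrier M" for y z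
      using that by (auto simp flip: add(1))
    show "a \<odot>\<^bsub>N\<^esub> y \<in> f ` carrier M" if "a \<in> carrier K" "y \<in> f ` carrier M" for a y
      using that by (auto simp flip: smult)
  qed
qed

context category_module
begin

lemma non_iso_image_submodule:
  assumes c: "c \<in> Obj C"
  shows "submodule (non_iso_image C M c) K (MObj M c)"
  unfolding non_iso_image_def
proof (rule module.sum_submodules_submodule[OF MObj_module[OF c]])
  fix u assume "u \<in> {u \<in> Arr C. Tgt C u = c \<and> \<not> is_iso C u}"
  then have u: "u \<in> Hom C (Src C u) c" by (auto simp: Hom_def)
  show "submodule (MMap M u ` carrier (MObj M (Src C u))) K (MObj M c)"
    using mod_hom_image_submodule MObj_module MMap_hom[OF u] hom_obj[OF u] by blast
qed

lemma non_iso_image_MMap: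
  assumes f: "f \<in> Hom C c d" "is_iso C f" and x: "x \<in> non_iso_image C M c"
  shows "MMap M f x \<in> non_iso_image C M d"
proof -
  let ?I = "\<lambda>c. {u \<in> Arr C. Tgt C u = c \<and> \<not> is_iso C u}"
  have cd: "c \<in> Obj C" "d \<in> Obj C" using hom_obj[OF f(1)] by auto
  interpret D: module K "MObj M d" by (rule MObj_module[OF cd(2)])
  interpret S: submodule "non_iso_image C M d" K "MObj M d"
    by (rule non_iso_image_submodule[OF cd(2)])
  obtain g F where g: "x = finsum (MObj M c) g F" "finite F" "F \<subseteq> ?I c"
    "\<forall>u\<in>F. g u \<in> MMap M u ` carrier (MObj M (Src C u))"
    using x by (auto simp: non_iso_image_def sum_submodules_def)
  have term_in: "MMap M f (g u) \<in> non_iso_image C M d \<and> g u \<in> carrier (MObj M c)"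
    if uF: "u \<in> F" for u
  proof -
    have u: "u \<in> Hom C (Src C u) c" "\<not> is_iso C u" using uF g(3) by (auto simp: Hom_def)
    obtain y where y: "y \<in> carrier (MObj M (Src C u))" "g u = MMap M u y"
      using bspec[OF g(4) uF] by auto
    let ?v = "Comp C f u"
    have v: "?v \<in> Hom C (Src C u) d" "\<not> is_iso C ?v"
      using comp_hom[OF u(1) f(1)] non_iso_comp_iso[OF u f] by auto
    have eq: "MMap M f (g u) = MMap M ?v y" using MMap_comp[OF u(1) f(1) y(1)] y(2) by simp
    have "MMap M f (g u) \<in> MMap M ?v ` carrier (MObj M (Src C ?v))"
      using eq y(1) v(1) by (auto simp: Hom_def)
    moreover have "MMap M f (g u) \<in> carrier (MObj M d)"
      using eq MMap_hom[OF v(1)] y(1) by (auto simp: mod_hom_def hom_def)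
    then have "MMap M f (g u) = finsum (MObj M d) (\<lambda>_. MMap M f (g u)) {?v}"
      by simp
    moreover have "{?v} \<subseteq> ?I d" using v by (auto simp: Hom_def)
    ultimately have "MMap M f (g u) \<in> non_iso_image C M d"
      unfolding non_iso_image_def
      by (intro sum_submodulesI[of _ _ "\<lambda>_. MMap M f (g u)" "{?v}"]) auto
    moreover have "g u \<in> carrier (MObj M c)"
      using y MMap_hom[OF u(1)] by (auto simp: mod_hom_def hom_def)
    ultimately show ?thesis ..
  qed
  then have "MMap M f x = finsum (MObj M d) (\<lambda>u. MMap M f (g u)) F"
    using mod_hom_module_sum[OF MObj_module[OF cd(1)] MObj_module[OF cd(2)] MMap_hom[OF f(1)]] g
    by blast
  moreover have "finsum (MObj M d) h F \<in> non_iso_image C M d"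
    if "\<forall>u\<in>F. h u \<in> non_iso_image C M d" for h
    using g(2) that
  proof (induction F rule: finite_induct)
    case empty
    then show ?case using S.one_closed by simp
  next
    case (insert u F)
    moreover have "h \<in> F \<rightarrow> carrier (MObj M d)" "h u \<in> carrier (MObj M d)"
      using insert.prems S.subset by auto
    ultimately show ?case using S.m_closed by simp
  qed
  ultimately show ?thesis using term_in by simp
qed

lemma splitting_MMap:
  assumes f: "f \<in> Hom C c d" "is_iso C f" and x: "x \<in> carrier (MObj M c)"
  shows "MMap (\<SS> C M) f (non_iso_image C M c +>\<^bsub>MObj M c\<^esub> x)
       = non_iso_image C M d +>\<^bsub>MObj M d\<^esub> MMap M f x"
proof -
  have cd: "c \<in> Obj C" "d \<in> Obj C" using hom_obj[OF f(1)] by auto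
  note sub = non_iso_image_submodule
  have eq: "non_iso_image C M d +>\<^bsub>MObj M d\<^esub> MMap M f y = non_iso_image C M d +>\<^bsub>MObj M d\<^esub> MMap M f x"
    if y: "y \<in> non_iso_image C M c +>\<^bsub>MObj M c\<^esub> x" for y
  proof -
    obtain h where h: "h \<in> non_iso_image C M c" "y = h \<oplus>\<^bsub>MObj M c\<^esub> x"
      using y a_r_coset_iff[of y "MObj M c" "non_iso_image C M c" x] by blast
    have hc: "h \<in> carrier (MObj M c)"
      using h(1) module.submoduleE(1)[OF MObj_module sub] cd by blast
    have "MMap M f y = MMap M f h \<oplus>\<^bsub>MObj M d\<^esub> MMap M f x" "MMap M f x \<in> carrier (MObj M d)"
      using MMap_hom[OF f(1)] h hc x by (auto simp: mod_hom_def hom_def)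
    then show ?thesis using non_iso_image_MMap[OF f h(1)]
      by (intro coset_eqI[OF MObj_module[OF cd(2)] sub[OF cd(2)]]) (auto simp: a_r_coset_iff)
  qed
  have "Tgt C f = d" using f by (simp add: Hom_def)
  then show ?thesis
    unfolding splitting_functor_def
    by (simp only: functor_data.simps) (rule coset_UN[OF MObj_module[OF cd(1)] sub[OF cd(1)] x], rule eq)
qed

lemma splitting_functor_module: "category_module K (iso_category C) (\<SS> C M)"
proof -
  note sub = non_iso_image_submodule
  have obj: "MObj (\<SS> C M) c = quotient_module (MObj M c) (non_iso_image C M c)" for c
    by (simp add: splitting_functor_def)
  have car: "X \<in> carrier (MObj (\<SS> C M) c) \<longleftrightarrow>
      (\<exists>x \<in> carrier (MObj M c). X = non_iso_image C M c +>\<^bsub>MObj M c\<^esub> x)"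
    if "c \<in> Obj C" for X c
    unfolding obj using quotient_carrier[OF MObj_module sub] that by blast
  have MM: "MMap M f x \<in> carrier (MObj M d)" if "f \<in> Hom C c d" "x \<in> carrier (MObj M c)" for f c d x
    using MMap_hom[OF that(1)] that(2) by (auto simp: mod_hom_def hom_def)
  show ?thesis
  proof (intro category_module.intro category_module_axioms.intro)
    show "cring K" by (rule is_cring)
    show "small_category (iso_category C)" by (rule iso_category_small)
  next
    fix c assume "c \<in> Obj (iso_category C)"
    then have c: "c \<in> Obj C" by simp
    show "module K (MObj (\<SS> C M) c)"
      unfolding obj by (rule quotient_module_module[OF MObj_module[OF c] sub[OF c]])
  next
    fix c X assume "c \<in> Obj (iso_category C)"
    then have c: "c \<in> Obj C" by simp
    assume "X \<in> carrier (MObj (\<SS> C M) c)"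
    then obtain x where "x \<in> carrier (MObj M c)" "X = non_iso_image C M c +>\<^bsub>MObj M c\<^esub> x"
      using car c by blast
    then show "MMap (\<SS> C M) (Ident (iso_category C) c) X = X"
      using splitting_MMap[OF ident_hom is_iso_ident] MMap_ident c by simp
  next
    fix u b c assume "u \<in> Hom (iso_category C) b c"
    then have u: "u \<in> Hom C b c" "is_iso C u" by (auto simp: iso_category_hom)
    then have bc: "b \<in> Obj C" "c \<in> Obj C" using hom_obj by auto
    note Qb = MObj_module[OF bc(1)] sub[OF bc(1)] and Qc = MObj_module[OF bc(2)] sub[OF bc(2)]
    interpret B: module K "MObj M b" by (rule Qb(1))
    have lin: "MMap M u (x \<oplus>\<^bsub>MObj M b\<^esub> y) = MMap M u x \<oplus>\<^bsub>MObj M c\<^esub> MMap M u y"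
      "a \<in> carrier K \<Longrightarrow> MMap M u (a \<odot>\<^bsub>MObj M b\<^esub> x) = a \<odot>\<^bsub>MObj M c\<^esub> MMap M u x"
      if "x \<in> carrier (MObj M b)" "y \<in> carrier (MObj M b)" for x y a
      using MMap_hom[OF u(1)] that by (auto simp: mod_hom_def hom_def)
    show "MMap (\<SS> C M) u \<in> mod_hom K (MObj (\<SS> C M) b) (MObj (\<SS> C M) c)"
      unfolding obj
    proof (rule mod_homI)
      let ?b = "quotient_module (MObj M b) (non_iso_image C M b)"
        and ?c = "quotient_module (MObj M c) (non_iso_image C M c)"
      note [simp] = splitting_MMap[OF u] MM[OF u(1)] lin quotient_carrierI[OF Qc]
        quotient_add[OF Qb] quotient_add[OF Qc] quotient_smult[OF Qb] quotient_smult[OF Qc]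
      note E = quotient_carrierE[OF Qb]
      show "MMap (\<SS> C M) u X \<in> carrier ?c" if "X \<in> carrier ?b" for X
        by (rule that[THEN E]) simp
      show "MMap (\<SS> C M) u (X \<oplus>\<^bsub>?b\<^esub> Y) = MMap (\<SS> C M) u X \<oplus>\<^bsub>?c\<^esub> MMap (\<SS> C M) u Y"
        if "X \<in> carrier ?b" "Y \<in> carrier ?b" for X Y
        by (rule that(1)[THEN E], rule that(2)[THEN E]) simp
      show "MMap (\<SS> C M) u (a \<odot>\<^bsub>?b\<^esub> X) = a \<odot>\<^bsub>?c\<^esub> MMap (\<SS> C M) u X"
        if "a \<in> carrier K" "X \<in> carrier ?b" for a X
        by (rule that(2)[THEN E]) (simp add: that(1))
    qed
  next
    fix u v a b c X
    assume "u \<in> Hom (iso_category C) a b" "v \<in> Hom (iso_category C) b c"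
      and X: "X \<in> carrier (MObj (\<SS> C M) a)"
    then have u: "u \<in> Hom C a b" "is_iso C u" and v: "v \<in> Hom C b c" "is_iso C v"
      by (auto simp: iso_category_hom)
    then have "a \<in> Obj C" using hom_obj by auto
    then obtain x where x: "x \<in> carrier (MObj M a)" "X = non_iso_image C M a +>\<^bsub>MObj M a\<^esub> x"
      using X car by blast
    then show "MMap (\<SS> C M) (Comp (iso_category C) v u) X = MMap (\<SS> C M) v (MMap (\<SS> C M) u X)"
      using splitting_MMap[OF comp_hom[OF u(1) v(1)] is_iso_comp[OF u v] x(1)]
        splitting_MMap[OF u x(1)] splitting_MMap[OF v MM[OF u(1) x(1)]] MMap_comp[OF u(1) v(1) x(1)]
      by simp
  qed
qed

end

end

theory Submission
  imports Defs
begin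

text \<open>
  Let \<open>c\<close> be an object whose isomorphism class is minimal in the support of \<open>M\<close>. A
  non-isomorphism \<open>u\<close> from \<open>b\<close> to \<open>c\<close> can only start at an object with \<open>M(b) = 0\<close>: otherwise
  minimality would make \<open>b\<close> isomorphic to \<open>c\<close>, and in an EI category every arrow between
  isomorphic objects is invertible (\<open>EI_category.is_iso_between_isomorphic\<close>). So all the images that
  are divided out of \<open>M(c)\<close> are zero (\<open>non_iso_image_eq_zero\<close>), and the quotient is as large as
  \<open>M(c)\<close> itself, which is nonzero.
\<close>

text \<open>Composing \<open>u\<close> with an isomorphism \<open>f\<close> back to its target gives an endomorphism, hence an
  isomorphism; since \<open>f\<close> is invertible as well, \<open>u\<close> itself must be.\<close>

lemma (in EI_category) is_iso_between_isomorphic: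
  assumes u: "u \<in> Hom C b c" and eq: "iso_class C b = iso_class C c"
  shows "is_iso C u"
proof (rule ccontr)
  assume "\<not> is_iso C u"
  moreover obtain f where f: "f \<in> Hom C c b" "is_iso C f"
    using iso_class_eq_iff[of c b] hom_obj[OF u] eq by auto
  ultimately have "\<not> is_iso C (Comp C f u)"
    using non_iso_comp_iso[OF u] by blast
  moreover have "is_iso C (Comp C f u)"
    using comp_hom[OF u f(1)] endo_iso by (auto simp: Hom_def)
  ultimately show False ..
qed

lemma (in module) sum_submodules_zero:
  assumes "\<And>i. i \<in> I \<Longrightarrow> S i \<subseteq> {\<zero>\<^bsub>M\<^esub>}"
  shows "sum_submodules M I S = {\<zero>\<^bsub>M\<^esub>}"
proof
  have "finsum M f F = \<zero>\<^bsub>M\<^esub>" if "F \<subseteq> I" "\<forall>i\<in>F. f i \<in> S i" for f F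
  proof (rule M.add.finprod_one_eqI)
    show "f i = \<zero>\<^bsub>M\<^esub>" if "i \<in> F" for i
      using that \<open>F \<subseteq> I\<close> \<open>\<forall>i\<in>F. f i \<in> S i\<close> assms by blast
  qed
  then show "sum_submodules M I S \<subseteq> {\<zero>\<^bsub>M\<^esub>}"
    unfolding sum_submodules_def by blast
  show "{\<zero>\<^bsub>M\<^esub>} \<subseteq> sum_submodules M I S"
    using sum_submodulesI[of "\<zero>\<^bsub>M\<^esub>" M undefined "{}" I S] by simp
qed

lemma mod_hom_image_zero_module:
  assumes M: "module K M" and N: "module K N" and f: "f \<in> mod_hom K M N"
    and "\<not> nonzero_module M"
  shows "f ` carrier M = {\<zero>\<^bsub>N\<^esub>}"
proof -
  interpret M: module K M by (rule M)
  interpret N: module K N by (rule N)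
  have "f \<zero>\<^bsub>M\<^esub> = \<zero>\<^bsub>N\<^esub>"
    using mod_hom_module_sum[OF M N f, of "{}" "\<lambda>_. \<zero>\<^bsub>M\<^esub>"] by simp
  with assms(4) show ?thesis by (simp add: nonzero_module_def)
qed

lemma (in category_module) non_iso_image_eq_zero:
  assumes c: "c \<in> Obj C"
    and zero: "\<And>b u. \<lbrakk>u \<in> Hom C b c; \<not> is_iso C u\<rbrakk> \<Longrightarrow> \<not> nonzero_module (MObj M b)"
  shows "non_iso_image C M c = {\<zero>\<^bsub>MObj M c\<^esub>}"
  unfolding non_iso_image_def
proof (rule module.sum_submodules_zero[OF MObj_module[OF c]])
  fix u assume "u \<in> {u \<in> Arr C. Tgt C u = c \<and> \<not> is_iso C u}"
  then have u: "u \<in> Hom C (Src C u) c" "\<not> is_iso C u" by (auto simp: Hom_def)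
  show "MMap M u ` carrier (MObj M (Src C u)) \<subseteq> {\<zero>\<^bsub>MObj M c\<^esub>}"
    using mod_hom_image_zero_module[OF MObj_module MObj_module MMap_hom[OF u(1)] zero[OF u]]
      hom_obj[OF u(1)] by simp
qed

lemma nonzero_quotient_by_zero:
  assumes N: "module K N" and nz: "nonzero_module N"
  shows "nonzero_module (quotient_module N {\<zero>\<^bsub>N\<^esub>})"
proof -
  interpret N: module K N by (rule N)
  obtain x where x: "x \<in> carrier N" "x \<noteq> \<zero>\<^bsub>N\<^esub>"
    using nz N.M.zero_closed by (auto simp: nonzero_module_def)
  have "{\<zero>\<^bsub>N\<^esub>} +>\<^bsub>N\<^esub> x = {x}"
    using x(1) by (auto simp: a_r_coset_iff)
  then have "{x} \<in> carrier (quotient_module N {\<zero>\<^bsub>N\<^esub>})"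
    using x(1) by (auto simp: quotient_module_def A_RCOSETS_def')
  moreover have "{x} \<noteq> \<zero>\<^bsub>quotient_module N {\<zero>\<^bsub>N\<^esub>}\<^esub>"
    using x(2) by (simp add: quotient_module_def)
  ultimately show ?thesis unfolding nonzero_module_def by blast
qed

theorem mainTheorem7:
  fixes K :: "('k, 'z) ring_scheme"
    and C :: "('o, 'a) category"
    and M :: "('o, 'a, 'k, 'm) functor_data"
  assumes "cring K"
    and "EI_category C"
    and "category_module K C M"
    and "\<exists>x. minimal_element (supp_order C M) x"
  shows "nonzero_functor (iso_category C) (\<SS> C M)"
proof -
  interpret EI_category C by fact
  interpret category_module K C M by fact
  obtain x where x: "minimal_element (supp_order C M) x" using assms(4) by blast
  then obtain c where c: "c \<in> Obj C" "nonzero_module (MObj M c)" and xc: "x = iso_class C c"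
    by (auto simp: minimal_element_def supp_order_def supp_def)
  have min: "iso_class C b = iso_class C c"
    if "b \<in> Obj C" "nonzero_module (MObj M b)" "Hom C b c \<noteq> {}" for b
  proof -
    have "iso_class C b \<in> supp C M" using that by (auto simp: supp_def)
    moreover have "iso_class C b \<sqsubseteq>\<^bsub>cl_order C\<^esub> iso_class C c"
      using that c(1) cl_le_iff by blast
    ultimately show ?thesis
      using x by (auto simp: xc minimal_element_def supp_order_def cl_order_def)
  qed
  have "non_iso_image C M c = {\<zero>\<^bsub>MObj M c\<^esub>}"
  proof (rule non_iso_image_eq_zero[OF c(1)])
    fix b u assume u: "u \<in> Hom C b c" "\<not> is_iso C u"
    show "\<not> nonzero_module (MObj M b)"
      using min[of b] is_iso_between_isomorphic[OF u(1)] hom_obj[OF u(1)] u by blast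
  qed
  then have "nonzero_module (MObj (\<SS> C M) c)"
    using nonzero_quotient_by_zero[OF MObj_module[OF c(1)] c(2)]
    by (simp add: splitting_functor_def)
  with c(1) show ?thesis by (auto simp: nonzero_functor_def)
qed

end
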